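(* Let $E$ be a complex Banach space, let $I=\mathbb{R}$ or $I=[0,\infty)$, and let $c\in\mathbb{C}\setminus\{0\}$ satisfy $|c|\neq 1$. If $f:I\to E$ is $c$-uniformly recurrent, then $f\equiv 0$.
   Context: For $c\in\mathbb{C}\setminus\{0\}$, a continuous function $f:I\to E$ is called $c$-uniformly recurrent if there exists a strictly increasing sequence $(\alpha_n)$ of positive real numbers with $\lim_{n\to+\infty}\alpha_n=+\infty$ and $\lim_{n\to+\infty}\sup_{t\in I}\|f(t+\alpha_n)-cf(t)\|=0$. The function $f$ is not assumed to be bounded. *)

theory Defs
  imports "HOL-Analysis.Analysis"
begin

text \<open>
  The class \<open>banach\<close> is about real scalars only.  A complex Banach space is a real Banach space
  whose real scalar multiplication extends to a complex one for which the norm is absolutely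
  homogeneous; the law \<open>1 *\<^sub>C x = x\<close> follows from \<open>scaleR_scaleC\<close>.
\<close>

class complex_banach = banach +
  fixes scaleC :: "complex \<Rightarrow> 'a \<Rightarrow> 'a"  (infixr \<open>*\<^sub>C\<close> 75)
  assumes scaleR_scaleC: "r *\<^sub>R x = complex_of_real r *\<^sub>C x"
    and scaleC_add_right: "a *\<^sub>C (x + y) = a *\<^sub>C x + a *\<^sub>C y"
    and scaleC_add_left: "(a + b) *\<^sub>C x = a *\<^sub>C x + b *\<^sub>C x"
    and scaleC_scaleC: "a *\<^sub>C (b *\<^sub>C x) = (a * b) *\<^sub>C x"
    and norm_scaleC: "norm (a *\<^sub>C x) = cmod a * norm x"

instantiation complex :: complex_banach
begin

definition scaleC_complex :: "complex \<Rightarrow> complex \<Rightarrow> complex"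
  where "scaleC_complex a x = a * x"

instance
  by standard (simp_all add: scaleC_complex_def algebra_simps norm_mult scaleR_conv_of_real)

end

text \<open>
  The supremum is taken in the extended reals because \<open>f\<close> may be unbounded, so that it can be
  infinite for some \<open>n\<close>; on \<open>real\<close> such a supremum would have an unspecified value.
\<close>

definition c_uniformly_recurrent ::
    "complex \<Rightarrow> real set \<Rightarrow> (real \<Rightarrow> 'a::complex_banach) \<Rightarrow> bool"
  where "c_uniformly_recurrent c I f \<longleftrightarrow>
    continuous_on I f \<and>
    (\<exists>\<alpha> :: nat \<Rightarrow> real.
       strict_mono \<alpha> \<and> (\<forall>n. \<alpha> n > 0) \<and> filterlim \<alpha> at_top sequentially \<and>
       (\<lambda>n. SUP t\<in>I. ereal (norm (f (t + \<alpha> n) - c *\<^sub>C f t))) \<longlonglongrightarrow> 0)"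

end

theory Submission
  imports Defs
begin

text \<open>
  Fix \<open>t0 \<in> I\<close> and look only at the real function \<open>u s = norm (f (t0 + s))\<close> for \<open>s \<ge> 0\<close>.  With
  \<open>C = cmod c\<close>, recurrence gives arbitrarily large shifts \<open>a\<close> for which \<open>u (s + a)\<close> is uniformly close
  to \<open>C * u s\<close>.  Iterating the shift, \<open>u\<close> behaves like \<open>C ^ (s / a)\<close>, and this for arbitrarily large
  \<open>a\<close>: the growth rate of \<open>u\<close> would have to be independent of \<open>a\<close>, which is impossible unless \<open>C = 1\<close>
  or \<open>u 0 = 0\<close>.

  If \<open>C < 1\<close>, already one good shift forces \<open>u\<close> to be small at infinity, and so
  \<open>C * u 0\<close>, being the limit of \<open>u\<close> along the shifts, vanishes
  (\<open>almost_multiplicative_decay\<close>).  If \<open>C > 1\<close> and \<open>u 0 > 0\<close>, iterating a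
  good shift \<open>a\<close> gives a lower bound of order \<open>C ^ k\<close> for \<open>u (k * a)\<close>, whereas iterating another good
  shift \<open>b \<ge> 2 * a\<close> gives an upper bound of order \<open>C ^ (k / 2)\<close>
  (\<open>almost_multiplicative_growth\<close>).  As \<open>f\<close> may be
  unbounded, all upper bounds start from the maximum of \<open>u\<close> on a compact interval
  (\<open>shift_growth_bound\<close>).
\<close>

text \<open>
  The number \<open>e / (1 - C)\<close> is the fixed point of \<open>x \<mapsto> C * x + e\<close>; measured from it, the affine
  recursion is a multiplication by \<open>C\<close>.  For \<open>C > 1\<close> the fixed point is negative.
\<close>

lemma iterated_shift_upper:
  fixes u :: "real \<Rightarrow> real"
  assumes C: "C > 0" "C \<noteq> 1" and a: "a \<ge> 0"
    and step: "\<And>t. t \<ge> 0 \<Longrightarrow> u (t + a) \<le> C * u t + e"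
    and t: "t \<ge> 0"
  shows "u (t + real k * a) - e / (1 - C) \<le> C ^ k * (u t - e / (1 - C))"
proof (induction k)
  case 0
  show ?case by simp
next
  case (Suc k)
  define p where "p = e / (1 - C)"
  have "p * (1 - C) = e"
    using C by (simp add: p_def)
  then have p: "e = p - C * p"
    by (simp add: algebra_simps)
  have "u (t + real (Suc k) * a) = u ((t + real k * a) + a)"
    by (simp add: algebra_simps)
  also have "\<dots> \<le> C * u (t + real k * a) + e"
    using t a by (intro step) simp
  finally have "u (t + real (Suc k) * a) - p \<le> C * (u (t + real k * a) - p)"
    using p by (simp add: algebra_simps)
  also have "\<dots> \<le> C * (C ^ k * (u t - p))"
    using Suc.IH C by (intro mult_left_mono) (simp_all add: p_def)
  finally show ?case by (simp add: p_def)
qed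

lemma iterated_shift_lower:
  fixes u :: "real \<Rightarrow> real"
  assumes "C > 0" "C \<noteq> 1" "a \<ge> 0"
    and step: "\<And>t. t \<ge> 0 \<Longrightarrow> C * u t - e \<le> u (t + a)"
    and "t \<ge> 0"
  shows "C ^ k * (u t + e / (1 - C)) \<le> u (t + real k * a) + e / (1 - C)"
proof -
  have "- u (t + a) \<le> C * (- u t) + e" if "t \<ge> 0" for t
    using step[OF that] by simp
  from iterated_shift_upper[of C a "\<lambda>t. - u t" e t k, OF assms(1-3) this assms(5)]
  show ?thesis by (simp add: algebra_simps)
qed

text \<open>
  Every \<open>t \<ge> 0\<close> is a point of the compact interval \<open>[0, a]\<close> shifted \<open>\<lfloor>t / a\<rfloor>\<close> times, so the maximum
  of \<open>u\<close> on that interval controls \<open>u\<close> on the whole half-line.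
\<close>

lemma shift_growth_bound:
  fixes u :: "real \<Rightarrow> real"
  assumes C: "C > 0" "C \<noteq> 1" and a: "a > 0"
    and cont: "continuous_on {0..} u"
    and step: "\<And>t. t \<ge> 0 \<Longrightarrow> u (t + a) \<le> C * u t + e"
  obtains M where "\<And>t. t \<ge> 0 \<Longrightarrow> u t \<le> e / (1 - C) + C ^ nat \<lfloor>t / a\<rfloor> * M"
proof -
  have "compact (u ` {0..a})"
    by (rule compact_continuous_image[OF continuous_on_subset[OF cont]]) auto
  then have "bdd_above (u ` {0..a})"
    by (intro bounded_imp_bdd_above compact_imp_bounded)
  then obtain B where "\<forall>y \<in> u ` {0..a}. y \<le> B"
    unfolding bdd_above_def by (rule exE)
  then have B: "u x \<le> B" if "x \<in> {0..a}" for x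
    using that by blast
  have "u t \<le> e / (1 - C) + C ^ nat \<lfloor>t / a\<rfloor> * (B - e / (1 - C))" if t: "t \<ge> 0" for t
  proof -
    define k where "k = nat \<lfloor>t / a\<rfloor>"
    define r where "r = t - real k * a"
    have "0 \<le> \<lfloor>t / a\<rfloor>" using t a by simp
    then have k: "real k = of_int \<lfloor>t / a\<rfloor>"
      by (simp add: k_def)
    have "real k \<le> t / a" "t / a \<le> real k + 1"
      unfolding k by linarith+
    then have r: "r \<in> {0..a}"
      using a by (simp add: r_def field_simps)
    have "u (r + real k * a) - e / (1 - C) \<le> C ^ k * (u r - e / (1 - C))"
      using iterated_shift_upper[of C a u e r k] C a step r by simp
    also have "\<dots> \<le> C ^ k * (B - e / (1 - C))"
      using B[OF r] C by (intro mult_left_mono) auto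
    finally show ?thesis by (simp add: r_def k_def)
  qed
  then show ?thesis by (rule that)
qed

text \<open>
  A single good shift already bounds the limit superior of \<open>u\<close> at infinity by a multiple of its
  tolerance.  The value \<open>u 0\<close> is then recovered from infinity through \<open>C * u 0 \<approx> u (\<alpha> n)\<close>.
\<close>

lemma almost_multiplicative_decay:
  fixes u :: "real \<Rightarrow> real"
  assumes C: "0 < C" "C < 1" and cont: "continuous_on {0..} u"
    and \<alpha>: "\<And>n. \<alpha> n > 0" "filterlim \<alpha> at_top sequentially"
    and close: "\<And>e. e > 0 \<Longrightarrow> \<forall>\<^sub>F n in sequentially. \<forall>t\<ge>0. \<bar>u (t + \<alpha> n) - C * u t\<bar> \<le> e"
  shows "u 0 \<le> 0"
proof -
  have "C * u 0 \<le> 0 + d" if d: "d > 0" for d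
  proof -
    \<comment> \<open>With tolerance \<open>e\<close>, the bound on \<open>u\<close> at infinity is \<open>e / (1 - C) = d / 2\<close>, and \<open>e \<le> d / 2\<close>.\<close>
    define e where "e = d / 2 * (1 - C)"
    have e: "e > 0" "e \<le> d / 2" "e / (1 - C) = d / 2"
      using C d by (auto simp: e_def field_simps)
    from close[OF e(1)] obtain m where m: "\<And>t. t \<ge> 0 \<Longrightarrow> \<bar>u (t + \<alpha> m) - C * u t\<bar> \<le> e"
      by (auto simp: eventually_sequentially)
    have step: "u (t + \<alpha> m) \<le> C * u t + e" if "t \<ge> 0" for t
      using m[OF that] by linarith
    have "C \<noteq> 1" using C by simp
    from shift_growth_bound[of C "\<alpha> m" u e, OF C(1) this \<alpha>(1) cont step]
    obtain M where M: "\<And>t. t \<ge> 0 \<Longrightarrow> u t \<le> e / (1 - C) + C ^ nat \<lfloor>t / \<alpha> m\<rfloor> * M"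
      by blast
    have "filterlim (\<lambda>n. \<alpha> n / \<alpha> m) at_top sequentially"
      using filterlim_at_top_mult_tendsto_pos[OF tendsto_const _ \<alpha>(2), of "1 / \<alpha> m"] \<alpha>(1)
      by simp
    then have "filterlim (\<lambda>n. nat \<lfloor>\<alpha> n / \<alpha> m\<rfloor>) sequentially sequentially"
      by (intro filterlim_compose[OF filterlim_nat_sequentially]
          filterlim_compose[OF filterlim_floor_sequentially])
    then have "(\<lambda>n. C ^ nat \<lfloor>\<alpha> n / \<alpha> m\<rfloor>) \<longlonglongrightarrow> 0"
      using C by (intro filterlim_compose[OF LIMSEQ_power_zero]) auto
    then have "(\<lambda>n. d / 2 + C ^ nat \<lfloor>\<alpha> n / \<alpha> m\<rfloor> * M + e) \<longlonglongrightarrow> d / 2 + 0 * M + e"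
      by (intro tendsto_intros)
    moreover have "\<forall>\<^sub>F n in sequentially. C * u 0 \<le> d / 2 + C ^ nat \<lfloor>\<alpha> n / \<alpha> m\<rfloor> * M + e"
      using close[OF e(1)]
    proof eventually_elim
      case (elim n)
      from elim[rule_format, of 0] have "C * u 0 \<le> u (\<alpha> n) + e" by simp
      with M[of "\<alpha> n"] \<alpha>(1)[of n] e(3) show ?case by simp
    qed
    ultimately have "C * u 0 \<le> d / 2 + 0 * M + e"
      by (rule tendsto_lowerbound) simp
    with e(2) show ?thesis by simp
  qed
  then have "C * u 0 \<le> 0"
    by (rule field_le_epsilon)
  with C show ?thesis
    by (simp add: mult_le_0_iff)
qed

text \<open>
  Here one shift cannot suffice: the function \<open>C powr (t / a)\<close> satisfies the recurrence exactly for
  the shift \<open>a\<close>.  The contradiction comes from comparing the growth rates that two shifts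
  \<open>a\<close> and \<open>b \<ge> 2 * a\<close> impose on the same function.
\<close>

lemma almost_multiplicative_growth:
  fixes u :: "real \<Rightarrow> real"
  assumes C: "C > 1" and cont: "continuous_on {0..} u"
    and \<alpha>: "\<And>n. \<alpha> n > 0" "filterlim \<alpha> at_top sequentially"
    and close: "\<And>e. e > 0 \<Longrightarrow> \<forall>\<^sub>F n in sequentially. \<forall>t\<ge>0. \<bar>u (t + \<alpha> n) - C * u t\<bar> \<le> e"
  shows "u 0 \<le> 0"
proof (rule ccontr)
  assume "\<not> u 0 \<le> 0"
  then have u0: "u 0 > 0" by simp
  \<comment> \<open>This tolerance makes the accumulated error \<open>e / (C - 1)\<close> only half of \<open>u 0\<close>.\<close>
  define e where "e = (C - 1) * (u 0 / 2)"
  have e: "e > 0" and p: "e / (1 - C) = - (u 0 / 2)"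
    using C u0 by (auto simp: e_def field_simps)
  from close[OF e] obtain m where m: "\<And>t. t \<ge> 0 \<Longrightarrow> \<bar>u (t + \<alpha> m) - C * u t\<bar> \<le> e"
    by (auto simp: eventually_sequentially)
  define a where "a = \<alpha> m"
  have a: "a > 0" using \<alpha>(1) by (simp add: a_def)
  have "\<forall>\<^sub>F n in sequentially. 2 * a \<le> \<alpha> n"
    using \<alpha>(2) by (simp add: filterlim_at_top)
  with close[OF e] have "\<forall>\<^sub>F n in sequentially.
      (\<forall>t\<ge>0. \<bar>u (t + \<alpha> n) - C * u t\<bar> \<le> e) \<and> 2 * a \<le> \<alpha> n"
    by (rule eventually_conj)
  then obtain b where b: "\<And>t. t \<ge> 0 \<Longrightarrow> \<bar>u (t + b) - C * u t\<bar> \<le> e" and ba: "2 * a \<le> b"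
    by (auto simp: eventually_sequentially)
  have step: "u (t + b) \<le> C * u t + e" if "t \<ge> 0" for t
    using b[OF that] by linarith
  have "C > 0" "C \<noteq> 1" "b > 0" using C a ba by simp_all
  from shift_growth_bound[of C b u e, OF this cont step]
  obtain M where M: "\<And>t. t \<ge> 0 \<Longrightarrow> u t \<le> e / (1 - C) + C ^ nat \<lfloor>t / b\<rfloor> * M"
    by blast
  have bound: "C ^ k * (u 0 / 2) \<le> \<bar>M\<bar>" for k
  proof -
    \<comment> \<open>This point is reached from \<open>0\<close> by \<open>2 * k\<close> shifts by \<open>a\<close>, but by at most \<open>k\<close> shifts by \<open>b\<close>
       from the compact interval.\<close>
    define t where "t = real (2 * k) * a"
    have t: "t \<ge> 0" using a by (simp add: t_def)
    have "C * u s - e \<le> u (s + a)" if "s \<ge> 0" for s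
      using m[OF that] by (simp add: a_def)
    from iterated_shift_lower[of C a u e 0 "2 * k", OF _ _ _ this] C a
    have "C ^ (2 * k) * (u 0 / 2) \<le> u t - u 0 / 2"
      by (simp add: t_def p)
    also have "\<dots> \<le> C ^ nat \<lfloor>t / b\<rfloor> * M"
      using M[OF t] u0 by (simp add: p)
    also have "\<dots> \<le> C ^ nat \<lfloor>t / b\<rfloor> * \<bar>M\<bar>"
      using C by (intro mult_left_mono) auto
    also have "\<dots> \<le> C ^ k * \<bar>M\<bar>"
    proof -
      have "t \<le> real k * b"
        using mult_left_mono[OF ba, of "real k"] by (simp add: t_def algebra_simps)
      then have "t / b \<le> real k"
        using a ba by (simp add: field_simps)
      then have "nat \<lfloor>t / b\<rfloor> \<le> k"
        by linarith
      then show ?thesis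
        using C by (intro mult_right_mono power_increasing) auto
    qed
    finally have "C ^ k * (C ^ k * (u 0 / 2)) \<le> C ^ k * \<bar>M\<bar>"
      by (simp add: mult_2 power_add mult.assoc)
    then show ?thesis using C by simp
  qed
  obtain k where "2 * \<bar>M\<bar> / u 0 < C ^ k"
    using real_arch_pow[OF C] by blast
  then have "\<bar>M\<bar> < C ^ k * (u 0 / 2)"
    using u0 by (simp add: field_simps)
  with bound[of k] show False by simp
qed

text \<open>
  Convergence of the extended-real suprema makes them finite from some index on, so the rest of the
  argument can use real estimates.
\<close>

lemma c_uniformly_recurrentE:
  assumes "c_uniformly_recurrent c I f"
  obtains \<alpha> :: "nat \<Rightarrow> real" where "continuous_on I f" "\<And>n. \<alpha> n > 0"
    "filterlim \<alpha> at_top sequentially"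
    "\<And>e. e > 0 \<Longrightarrow> \<forall>\<^sub>F n in sequentially. \<forall>t\<in>I. norm (f (t + \<alpha> n) - c *\<^sub>C f t) \<le> e"
proof -
  from assms obtain \<alpha> :: "nat \<Rightarrow> real" where \<alpha>: "continuous_on I f" "\<And>n. \<alpha> n > 0"
      "filterlim \<alpha> at_top sequentially"
    and lim: "(\<lambda>n. SUP t\<in>I. ereal (norm (f (t + \<alpha> n) - c *\<^sub>C f t))) \<longlonglongrightarrow> 0"
    unfolding c_uniformly_recurrent_def by auto
  have "\<forall>\<^sub>F n in sequentially. \<forall>t\<in>I. norm (f (t + \<alpha> n) - c *\<^sub>C f t) \<le> e" if "e > 0" for e
  proof -
    have "\<forall>\<^sub>F n in sequentially. (SUP t\<in>I. ereal (norm (f (t + \<alpha> n) - c *\<^sub>C f t))) < ereal e"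
      using lim that by (intro order_tendstoD(2)) auto
    then show ?thesis
    proof eventually_elim
      case (elim n)
      show ?case
      proof
        fix t assume "t \<in> I"
        then have "ereal (norm (f (t + \<alpha> n) - c *\<^sub>C f t))
            \<le> (SUP t\<in>I. ereal (norm (f (t + \<alpha> n) - c *\<^sub>C f t)))"
          by (rule SUP_upper)
        with elim have "ereal (norm (f (t + \<alpha> n) - c *\<^sub>C f t)) < ereal e"
          by (rule le_less_trans[rotated])
        then show "norm (f (t + \<alpha> n) - c *\<^sub>C f t) \<le> e" by simp
      qed
    qed
  qed
  with \<alpha> show ?thesis by (rule that)
qed

theorem proposition2p6:
  fixes f :: "real \<Rightarrow> 'a::complex_banach" and I :: "real set" and c :: complex
  assumes "I = UNIV \<or> I = {0..}"
    and "c \<noteq> 0"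
    and "cmod c \<noteq> 1"
    and "c_uniformly_recurrent c I f"
  shows "\<forall>t\<in>I. f t = 0"
proof
  fix t0 assume t0: "t0 \<in> I"
  from assms(4) obtain \<alpha> :: "nat \<Rightarrow> real" where cont: "continuous_on I f"
    and \<alpha>: "\<And>n. \<alpha> n > 0" "filterlim \<alpha> at_top sequentially"
    and rec: "\<And>e. e > 0 \<Longrightarrow> \<forall>\<^sub>F n in sequentially. \<forall>t\<in>I. norm (f (t + \<alpha> n) - c *\<^sub>C f t) \<le> e"
    by (rule c_uniformly_recurrentE) blast
  define u where "u s = norm (f (t0 + s))" for s
  have shift: "t0 + s \<in> I" if "s \<ge> 0" for s
    using assms(1) t0 that by auto
  have u_cont: "continuous_on {0..} u"
  proof -
    have "(\<lambda>s. t0 + s) ` {0..} \<subseteq> I" using shift by blast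
    then show ?thesis
      unfolding u_def
      by (intro continuous_on_norm continuous_on_compose2[OF cont]) (intro continuous_intros)
  qed
  have close: "\<forall>\<^sub>F n in sequentially. \<forall>s\<ge>0. \<bar>u (s + \<alpha> n) - cmod c * u s\<bar> \<le> e" if "e > 0" for e
    using rec[OF that]
  proof eventually_elim
    case (elim n)
    show ?case
    proof (intro allI impI)
      fix s :: real assume "s \<ge> 0"
      then have "norm (f (t0 + s + \<alpha> n) - c *\<^sub>C f (t0 + s)) \<le> e"
        using elim shift by blast
      then have "\<bar>norm (f (t0 + s + \<alpha> n)) - norm (c *\<^sub>C f (t0 + s))\<bar> \<le> e"
        using norm_triangle_ineq3 order_trans by blast
      then show "\<bar>u (s + \<alpha> n) - cmod c * u s\<bar> \<le> e"
        by (simp add: u_def norm_scaleC add.assoc)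
    qed
  qed
  have "cmod c > 0" using assms(2) by simp
  have "u 0 \<le> 0"
  proof (cases "cmod c < 1")
    case True
    show ?thesis
      by (rule almost_multiplicative_decay[OF \<open>cmod c > 0\<close> True u_cont \<alpha> close])
  next
    case False
    with assms(3) have "cmod c > 1" by simp
    then show ?thesis
      by (rule almost_multiplicative_growth[OF _ u_cont \<alpha> close])
  qed
  then show "f t0 = 0" by (simp add: u_def)
qed

end
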